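(* For every $d \in \mathbb{N}$ and every $\varepsilon > \sqrt{d}/\binom{d+1}{2}$, there is an $\varepsilon$-almost regular $d$-simplex which is not diameter-Ramsey.
   Context: $\mathbb{N}$ denotes the positive integers and $\|\cdot\|$ the Euclidean norm. The diameter of a set $P \subset \mathbb{R}^d$ is $\mathrm{diam}(P) := \sup\{\|x-y\| : x,y \in P\}$. A $d$-simplex is identified with its vertex set, i.e. it is a set $A = \{p_1,\ldots,p_{d+1}\} \subset \mathbb{R}^d$ of $d+1$ affinely independent points. It is called $\varepsilon$-almost regular if $$\frac{1}{\binom{d+1}{2}} \sum_{1 \le i < j \le d+1} \left( \mathrm{diam}(A)^2 - \|p_i - p_j\|^2 \right) \le \varepsilon \cdot \mathrm{diam}(A)^2 .$$ Two sets, possibly in Euclidean spaces of different dimensions, are congruent if there is a distance-preserving bijection between them. A finite set $A \subset \mathbb{R}^d$ is called diameter-Ramsey if for every $r \in \mathbb{N}$ there exist $n \in \mathbb{N}$ and a finite set $B \subset \mathbb{R}^n$ with $\mathrm{diam}(B) = \mathrm{diam}(A)$ such that whenever the points of $B$ are coloured with $r$ colours, there is a monochromatic set $A' \subset B$ (all points of $A'$ have the same colour) which is congruent to $A$.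
   Formalization: The formal theorem requires d ≥ 2; for d = 1 the claim is false, since every two-point set is diameter-Ramsey (colour the r+1 vertices of a regular simplex of that edge length with r colours). *)

theory Defs
  imports "HOL-Analysis.Analysis"
begin

text \<open>
  Fixed dimensions \<open>d\<close> are rendered by the type \<^typ>\<open>real ^ 'd\<close>. The definition of
  diameter-Ramsey sets quantifies over the dimension \<open>n\<close> of a second space, so that space is
  rendered with an explicit carrier: sequences vanishing from index \<open>n\<close> on. This is the
  carrier of the library's \<^const>\<open>Euclidean_space\<close>.
\<close>

definition Rn :: "nat \<Rightarrow> (nat \<Rightarrow> real) set" where
  "Rn n = {x. \<forall>i\<ge>n. x i = 0}"

definition Rn_dist :: "nat \<Rightarrow> (nat \<Rightarrow> real) \<Rightarrow> (nat \<Rightarrow> real) \<Rightarrow> real" where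
  "Rn_dist n x y = L2_set (\<lambda>i. x i - y i) {..<n}"

text \<open>Same shape as the library's \<^const>\<open>diameter\<close>, including the value 0 on the empty set.\<close>

definition Rn_diameter :: "nat \<Rightarrow> (nat \<Rightarrow> real) set \<Rightarrow> real" where
  "Rn_diameter n P = (if P = {} then 0 else SUP (x, y)\<in>P \<times> P. Rn_dist n x y)"

definition congruent_in_Rn :: "nat \<Rightarrow> 'a::metric_space set \<Rightarrow> (nat \<Rightarrow> real) set \<Rightarrow> bool" where
  "congruent_in_Rn n A A' \<longleftrightarrow>
     (\<exists>f. bij_betw f A A' \<and> (\<forall>x\<in>A. \<forall>y\<in>A. Rn_dist n (f x) (f y) = dist x y))"

definition diameter_Ramsey :: "'a::euclidean_space set \<Rightarrow> bool" where
  "diameter_Ramsey A \<longleftrightarrow> finite A \<and>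
     (\<forall>r\<ge>1. \<exists>n\<ge>1. \<exists>B. B \<subseteq> Rn n \<and> finite B \<and> Rn_diameter n B = diameter A \<and>
        (\<forall>c::(nat \<Rightarrow> real) \<Rightarrow> nat. c ` B \<subseteq> {..<r} \<longrightarrow>
           (\<exists>A'\<subseteq>B. (\<exists>k. \<forall>x\<in>A'. c x = k) \<and> congruent_in_Rn n A A')))"

text \<open>
  A simplex is its vertex set (the library's \<open>simplex\<close> in \<open>Polytope\<close> is the convex hull).
\<close>

definition vertex_simplex :: "nat \<Rightarrow> 'a::euclidean_space set \<Rightarrow> bool" where
  "vertex_simplex d A \<longleftrightarrow> card A = d + 1 \<and> \<not> affine_dependent A"

text \<open>
  The sum runs over all unordered pairs of vertices, so its value does not depend on the
  enumeration \<open>p\<close>.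
\<close>

definition almost_regular_simplex :: "nat \<Rightarrow> real \<Rightarrow> 'a::euclidean_space set \<Rightarrow> bool" where
  "almost_regular_simplex d \<epsilon> A \<longleftrightarrow> vertex_simplex d A \<and>
     (\<exists>p. bij_betw p {1..d+1} A \<and>
        1 / real ((d + 1) choose 2) *
          (\<Sum>(i, j)\<in>{(i, j). 1 \<le> i \<and> i < j \<and> j \<le> d + 1}.
             (diameter A)\<^sup>2 - (norm (p i - p j))\<^sup>2)
        \<le> \<epsilon> * (diameter A)\<^sup>2)"

text \<open>
  Every two-point set is diameter-Ramsey: among the \<open>r + 1\<close> vertices of a regular simplex of
  the right edge length, two get the same one of \<open>r\<close> colours. Hence every 1-simplex is
  diameter-Ramsey, and the existence of non-diameter-Ramsey \<open>d\<close>-simplices can only be claimed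
  for \<open>d \<ge> 2\<close>.
\<close>

lemma diameter_Ramsey_two_points:
  fixes A :: "'a::euclidean_space set"
  assumes "card A = 2"
  shows "diameter_Ramsey A"
proof -
  obtain a b where ab: "A = {a, b}" "a \<noteq> b"
    using assms by (auto simp: card_2_iff)
  define D where "D = dist a b"
  have D: "D > 0" using ab D_def by simp
  have diam: "diameter A = D"
    unfolding diameter_def ab D_def
    by (simp add: dist_commute)
       (auto intro!: cSup_eq_maximum simp: dist_commute)
  have "\<exists>n\<ge>1. \<exists>B. B \<subseteq> Rn n \<and> finite B \<and> Rn_diameter n B = diameter A \<and>
        (\<forall>c::(nat \<Rightarrow> real) \<Rightarrow> nat. c ` B \<subseteq> {..<r} \<longrightarrow>
           (\<exists>A'\<subseteq>B. (\<exists>k. \<forall>x\<in>A'. c x = k) \<and> congruent_in_Rn n A A'))" if "r \<ge> 1" for r :: nat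
  proof -
    define n where "n = r + 1"
    define e where "e = (\<lambda>(i::nat) (j::nat). if i = j then D / sqrt 2 else (0::real))"
    define B where "B = e ` {..<n}"
    have dist_e: "Rn_dist n (e i) (e j) = (if i = j then 0 else D)" if "i < n" "j < n" for i j
    proof (cases "i = j")
      case False
      have "(\<Sum>k<n. (e i k - e j k)\<^sup>2) = (\<Sum>k\<in>{i, j}. (e i k - e j k)\<^sup>2)"
        using that by (intro sum.mono_neutral_right) (auto simp: e_def)
      also have "\<dots> = D\<^sup>2"
        using False by (simp add: e_def power_divide)
      finally show ?thesis
        using False D by (simp add: Rn_dist_def L2_set_def)
    qed (simp add: Rn_dist_def L2_set_def)
    have inj: "inj_on e {..<n}"
      using D by (intro inj_onI) (metis dist_e less_irrefl lessThan_iff)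
    have "Rn_diameter n B = D"
    proof -
      have mem: "e 0 \<in> B" "e 1 \<in> B" "Rn_dist n (e 0) (e 1) = D"
        using that dist_e[of 0 1] by (auto simp: B_def n_def)
      have "(SUP (x, y)\<in>B \<times> B. Rn_dist n x y) = D"
      proof (rule cSup_eq_maximum)
        show "D \<in> (\<lambda>(x, y). Rn_dist n x y) ` (B \<times> B)"
          using mem by force
      next
        fix z assume "z \<in> (\<lambda>(x, y). Rn_dist n x y) ` (B \<times> B)"
        then show "z \<le> D"
          using D by (auto simp: B_def dist_e)
      qed
      then show ?thesis using mem by (auto simp: Rn_diameter_def)
    qed
    moreover have "\<exists>A'\<subseteq>B. (\<exists>k. \<forall>x\<in>A'. c x = k) \<and> congruent_in_Rn n A A'"
      if c: "c ` B \<subseteq> {..<r}" for c :: "(nat \<Rightarrow> real) \<Rightarrow> nat"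
    proof -
      have "card B = r + 1" using card_image[OF inj] by (simp add: B_def n_def)
      moreover have "card (c ` B) \<le> r"
        using card_mono[OF _ c] by simp
      ultimately have "\<not> inj_on c B"
        using card_image[of c B] by (intro notI) simp
      then obtain x y where xy: "x \<in> B" "y \<in> B" "x \<noteq> y" "c x = c y"
        unfolding inj_on_def by blast
      obtain i j where "x = e i" "y = e j" "i < n" "j < n"
        using xy(1,2) by (auto simp: B_def)
      with xy(3) have xyD: "Rn_dist n x y = D" "Rn_dist n y x = D"
        "Rn_dist n x x = 0" "Rn_dist n y y = 0"
        by (auto simp: dist_e)
      have "congruent_in_Rn n A {x, y}"
        unfolding congruent_in_Rn_def
      proof (intro exI conjI)
        show "bij_betw (\<lambda>z. if z = a then x else y) A {x, y}"
          using ab xy by (auto simp: bij_betw_def inj_on_def)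
        show "\<forall>u\<in>A. \<forall>v\<in>A. Rn_dist n (if u = a then x else y) (if v = a then x else y) = dist u v"
          using ab xyD by (auto simp: D_def dist_commute)
      qed
      moreover have "{x, y} \<subseteq> B" "\<forall>z\<in>{x, y}. c z = c x"
        using xy by auto
      ultimately show ?thesis
        by (intro exI[of _ "{x, y}"] conjI exI[of _ "c x"])
    qed
    moreover have "B \<subseteq> Rn n" "finite B" "n \<ge> 1"
      by (auto simp: B_def Rn_def e_def n_def)
    ultimately show ?thesis
      unfolding diam by - (rule exI[of _ n], rule conjI, assumption, rule exI[of _ B], simp)
  qed
  then show ?thesis
    unfolding diameter_Ramsey_def using ab(1) by simp
qed

end

theory Submission
  imports Defs
begin

text \<open>
  Every set of diameter \<open>D\<close> lies, up to an arbitrarily small error, in a ball of radius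
  \<open>D / sqrt 2\<close> (Jung). Colour its points by thin concentric shells about the centre of that ball;
  the number of shells does not depend on the dimension. A monochromatic copy of \<open>A\<close> lies almost
  on a sphere of radius at most \<open>D / sqrt 2\<close>, which is impossible if the circumradius of \<open>A\<close>
  exceeds \<open>D / sqrt 2\<close>. The simplex whose vertices are the standard basis of \<open>\<real>\<^sup>d\<close> and
  \<open>s (1, \<dots>, 1)\<close> has diameter \<open>sqrt 2\<close>. For \<open>s = 1 / sqrt d\<close> it is inscribed in the unit
  sphere, and any slightly smaller \<open>s\<close> makes its circumradius exceed 1.
\<close>

section \<open>Variance identities for weighted point sets\<close>

text \<open>Parallel axis identity: in terms of the moments \<open>m\<close> and \<open>v\<close>,
  both sides equal \<open>v - 2 * q * m + q\<^sup>2\<close>. It will be applied to probability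
  weights and to barycentric coordinates with negative entries.\<close>

lemma weighted_variance:
  fixes w f :: "'b \<Rightarrow> real"
  assumes "sum w A = 1"
  shows "(\<Sum>x\<in>A. w x * (f x - q)\<^sup>2) =
    ((\<Sum>x\<in>A. w x * f x) - q)\<^sup>2 + (\<Sum>x\<in>A. \<Sum>y\<in>A. w x * w y * (f x - f y)\<^sup>2) / 2"
proof -
  define m v where "m = (\<Sum>x\<in>A. w x * f x)" and "v = (\<Sum>x\<in>A. w x * (f x)\<^sup>2)"
  have sq: "(\<Sum>x\<in>A. w x * (f x - t)\<^sup>2) = v - 2 * t * m + t\<^sup>2" for t
  proof -
    have "(\<Sum>x\<in>A. w x * (f x - t)\<^sup>2) = (\<Sum>x\<in>A. w x * (f x)\<^sup>2 - 2 * t * (w x * f x) + t\<^sup>2 * w x)"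
      by (intro sum.cong) (auto simp: power2_eq_square algebra_simps)
    also have "\<dots> = v - 2 * t * m + t\<^sup>2 * sum w A"
      by (simp add: sum.distrib sum_subtractf sum_distrib_left m_def v_def)
    finally show ?thesis using assms by simp
  qed
  have "(\<Sum>x\<in>A. \<Sum>y\<in>A. w x * w y * (f x - f y)\<^sup>2) =
      (\<Sum>x\<in>A. w x * (\<Sum>y\<in>A. w y * (f y - f x)\<^sup>2))"
    by (simp add: sum_distrib_left mult.assoc power2_commute)
  also have "\<dots> = (\<Sum>x\<in>A. v * w x - 2 * m * (w x * f x) + w x * (f x)\<^sup>2)"
    by (intro sum.cong) (auto simp: sq algebra_simps)
  also have "\<dots> = v * sum w A - 2 * m * m + v"
    by (simp add: sum.distrib sum_subtractf sum_distrib_left m_def v_def)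
  finally have pairs: "(\<Sum>x\<in>A. \<Sum>y\<in>A. w x * w y * (f x - f y)\<^sup>2) = 2 * v - 2 * m\<^sup>2"
    using assms by (simp add: power2_eq_square)
  show ?thesis
    unfolding pairs sq m_def[symmetric] by (simp add: power2_eq_square field_simps)
qed

lemma Rn_dist_nonneg: "0 \<le> Rn_dist n x y"
  by (simp add: Rn_dist_def)

lemma Rn_dist_self: "Rn_dist n x x = 0"
  by (simp add: Rn_dist_def L2_set_def)

lemma Rn_dist_commute: "Rn_dist n x y = Rn_dist n y x"
  by (simp add: Rn_dist_def L2_set_def power2_commute)

lemma Rn_dist_power2: "(Rn_dist n x y)\<^sup>2 = (\<Sum>k<n. (x k - y k)\<^sup>2)"
  by (simp add: Rn_dist_def L2_set_def sum_nonneg)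

text \<open>The scalar identity summed over coordinates. The map \<open>f\<close> lets it serve both
  the points of \<open>B\<close> and an embedded copy of \<open>A\<close>.\<close>

lemma Rn_weighted_variance:
  assumes "sum w A = 1"
  shows "(\<Sum>x\<in>A. w x * (Rn_dist n (f x) q)\<^sup>2) =
    (Rn_dist n (\<lambda>k. \<Sum>x\<in>A. w x * f x k) q)\<^sup>2 +
    (\<Sum>x\<in>A. \<Sum>y\<in>A. w x * w y * (Rn_dist n (f x) (f y))\<^sup>2) / 2"
proof -
  have "(\<Sum>x\<in>A. w x * (Rn_dist n (f x) q)\<^sup>2) = (\<Sum>k<n. \<Sum>x\<in>A. w x * (f x k - q k)\<^sup>2)"
    unfolding Rn_dist_power2 sum_distrib_left by (rule sum.swap)
  also have "\<dots> = (\<Sum>k<n. ((\<Sum>x\<in>A. w x * f x k) - q k)\<^sup>2) +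
      (\<Sum>k<n. \<Sum>x\<in>A. \<Sum>y\<in>A. w x * w y * (f x k - f y k)\<^sup>2) / 2"
    by (simp add: weighted_variance[OF assms] sum.distrib sum_divide_distrib)
  also have "(\<Sum>k<n. \<Sum>x\<in>A. \<Sum>y\<in>A. w x * w y * (f x k - f y k)\<^sup>2) =
      (\<Sum>x\<in>A. \<Sum>k<n. \<Sum>y\<in>A. w x * w y * (f x k - f y k)\<^sup>2)"
    by (rule sum.swap)
  also have "\<dots> = (\<Sum>x\<in>A. \<Sum>y\<in>A. w x * w y * (Rn_dist n (f x) (f y))\<^sup>2)"
    unfolding Rn_dist_power2 sum_distrib_left by (intro sum.cong sum.swap refl)
  finally show ?thesis by (simp add: Rn_dist_power2)
qed

text \<open>Expresses squared distances to the barycentre through pairwise distances, which are the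
  data that a congruence preserves.\<close>

lemma weighted_variance_inner:
  fixes A :: "'a::real_inner set"
  assumes "sum w A = 1"
  shows "(\<Sum>x\<in>A. \<Sum>y\<in>A. w x * w y * (dist x y)\<^sup>2) / 2 =
    (\<Sum>x\<in>A. w x * (dist x (\<Sum>y\<in>A. w y *\<^sub>R y))\<^sup>2)"
proof -
  define m v where "m = (\<Sum>x\<in>A. w x *\<^sub>R x)" and "v = (\<Sum>x\<in>A. w x * (x \<bullet> x))"
  have sq: "(\<Sum>x\<in>A. w x * (dist x t)\<^sup>2) = v - 2 * (m \<bullet> t) + t \<bullet> t" for t
  proof -
    have "(\<Sum>x\<in>A. w x * (dist x t)\<^sup>2) =
        (\<Sum>x\<in>A. w x * (x \<bullet> x) - 2 * (w x * (x \<bullet> t)) + (t \<bullet> t) * w x)"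
      by (intro sum.cong) (auto simp: dist_norm power2_norm_eq_inner inner_diff inner_commute algebra_simps)
    also have "\<dots> = v - 2 * (m \<bullet> t) + (t \<bullet> t) * sum w A"
      by (simp add: sum.distrib sum_subtractf sum_distrib_left m_def v_def inner_sum_left)
    finally show ?thesis using assms by simp
  qed
  have "(\<Sum>x\<in>A. \<Sum>y\<in>A. w x * w y * (dist x y)\<^sup>2) =
      (\<Sum>x\<in>A. w x * (\<Sum>y\<in>A. w y * (dist y x)\<^sup>2))"
    by (simp add: sum_distrib_left mult.assoc dist_commute)
  also have "\<dots> = (\<Sum>x\<in>A. v * w x - 2 * (w x * (x \<bullet> m)) + w x * (x \<bullet> x))"
    by (intro sum.cong) (auto simp: sq algebra_simps inner_commute)
  also have "\<dots> = v * sum w A - 2 * (m \<bullet> m) + v"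
    by (simp add: sum.distrib sum_subtractf sum_distrib_left m_def v_def inner_sum_left)
  finally show ?thesis
    using assms sq[of m] by (simp add: m_def[symmetric])
qed

section \<open>Jung's theorem up to a small error\<close>

text \<open>
  A form of Jung's theorem. The barycentre of weights that nearly maximise the mean squared
  distance of two independent points is almost equally far from all points carrying weight
  and no farther from the others, as is seen by shifting a little weight to one point \<open>z\<close>.
\<close>

lemma Rn_jung:
  assumes fin: "finite B" and ne: "B \<noteq> {}" and \<eta>: "\<eta> > 0"
    and D: "\<And>x y. x \<in> B \<Longrightarrow> y \<in> B \<Longrightarrow> Rn_dist n x y \<le> D"
  obtains q where "\<And>z. z \<in> B \<Longrightarrow> (Rn_dist n z q)\<^sup>2 \<le> D\<^sup>2 / 2 + \<eta>"
proof -
  define F where "F = (\<lambda>w. (\<Sum>x\<in>B. \<Sum>y\<in>B. w x * w y * (Rn_dist n x y)\<^sup>2) / 2)"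
  define W where "W = {w::(nat \<Rightarrow> real) \<Rightarrow> real. (\<forall>x\<in>B. 0 \<le> w x) \<and> sum w B = 1}"
  have F_le: "F w \<le> D\<^sup>2 / 2" if "w \<in> W" for w
  proof -
    have "(\<Sum>x\<in>B. \<Sum>y\<in>B. w x * w y * (Rn_dist n x y)\<^sup>2) \<le> (\<Sum>x\<in>B. \<Sum>y\<in>B. w x * w y * D\<^sup>2)"
      using that D by (intro sum_mono mult_left_mono power_mono) (auto simp: W_def Rn_dist_nonneg)
    also have "\<dots> = (\<Sum>x\<in>B. \<Sum>y\<in>B. w x * w y) * D\<^sup>2"
      by (simp only: sum_distrib_right)
    also have "\<dots> = (sum w B)\<^sup>2 * D\<^sup>2"
      by (simp only: power2_eq_square sum_product)
    finally show ?thesis using that by (simp add: F_def W_def)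
  qed
  obtain b where b: "b \<in> B" using ne by blast
  have "(\<lambda>x. if x = b then 1 else 0) \<in> W"
    using fin b by (auto simp: W_def)
  then have Wne: "W \<noteq> {}" by blast
  have bdd: "bdd_above (F ` W)" using F_le by (rule bdd_aboveI2)
  \<comment> \<open>Chosen so that \<open>t * K = \<eta>\<close> turns
    \<open>(1 - t) * (D\<^sup>2 / 2 + \<eta>)\<close> into \<open>D\<^sup>2 / 2 + t\<close>, the
    bound reached at the end.\<close>
  define K where "K = 1 + D\<^sup>2 / 2 + \<eta>"
  define t where "t = \<eta> / K"
  have K: "\<eta> < K" by (simp add: K_def add_pos_nonneg)
  then have t: "0 < t" "t < 1" "t * K = \<eta>"
    using \<eta> by (auto simp: t_def)
  \<comment> \<open>A near maximiser suffices: shifting weight \<open>t\<close> changes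
    \<open>F\<close> to first order in \<open>t\<close>, so a defect below \<open>t\<^sup>2\<close>
    costs less than \<open>t\<close> after division by \<open>t\<close>.\<close>
  have "Sup (F ` W) - t\<^sup>2 < Sup (F ` W)" using t by simp
  then obtain w where w: "w \<in> W" "Sup (F ` W) - t\<^sup>2 < F w"
    using less_cSupE[of _ "F ` W"] Wne by blast
  define q where "q = (\<lambda>k. \<Sum>x\<in>B. w x * x k)"
  have "(Rn_dist n z q)\<^sup>2 \<le> D\<^sup>2 / 2 + \<eta>" if z: "z \<in> B" for z
  proof -
    define e where "e = (\<lambda>x. if x = z then 1 else 0 :: real)"
    define w' where "w' = (\<lambda>x. (1 - t) * w x + t * e x)"
    define a where "a = (\<Sum>x\<in>B. w x * (Rn_dist n x z)\<^sup>2)"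
    have e: "sum e B = 1" "\<And>g. (\<Sum>x\<in>B. e x * g x) = g z"
      using fin z by (auto simp: e_def if_distrib[of "\<lambda>u. u * _"] cong: if_cong)
    have "w' \<in> W"
      using w(1) t e by (auto simp: W_def w'_def sum.distrib sum_distrib_left[symmetric] e_def)
    then have "F w' \<le> Sup (F ` W)" using bdd by (intro cSup_upper) auto
    with w(2) have less: "F w' < F w + t\<^sup>2" by simp
    \<comment> \<open>Bilinear expansion, where \<open>e\<close> is the point mass at
      \<open>z\<close>. The term with \<open>e\<close> twice is the squared distance from
      \<open>z\<close> to itself, hence 0.\<close>
    have "(\<Sum>x\<in>B. \<Sum>y\<in>B. w' x * w' y * (Rn_dist n x y)\<^sup>2) =
        (1 - t)\<^sup>2 * (\<Sum>x\<in>B. \<Sum>y\<in>B. w x * w y * (Rn_dist n x y)\<^sup>2)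
        + (1 - t) * t * (\<Sum>x\<in>B. w x * (\<Sum>y\<in>B. e y * (Rn_dist n x y)\<^sup>2))
        + (1 - t) * t * (\<Sum>x\<in>B. e x * (\<Sum>y\<in>B. w y * (Rn_dist n x y)\<^sup>2))
        + t\<^sup>2 * (\<Sum>x\<in>B. e x * (\<Sum>y\<in>B. e y * (Rn_dist n x y)\<^sup>2))"
      unfolding w'_def sum_distrib_left sum.distrib[symmetric]
      by (intro sum.cong refl) (simp add: power2_eq_square algebra_simps)
    also have "\<dots> = (1 - t)\<^sup>2 * (2 * F w) + 2 * ((1 - t) * t * a)"
      unfolding e(2) by (simp add: F_def a_def Rn_dist_self Rn_dist_commute[of n z])
    finally have Fw': "F w' = (1 - t)\<^sup>2 * F w + (1 - t) * t * a"
      by (simp add: F_def)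
    \<comment> \<open>With the variance identity at \<open>z\<close>, \<open>F w' - F w\<close>
      becomes \<open>t * ((1 - t) * (Rn_dist n z q)\<^sup>2 - F w)\<close>, which is below
      \<open>t\<^sup>2\<close>.\<close>
    have "a = (Rn_dist n z q)\<^sup>2 + F w"
      using Rn_weighted_variance[of w B n "\<lambda>x. x" z] w(1)
      by (simp add: a_def F_def W_def q_def Rn_dist_commute[of n z])
    with less Fw' have "t * ((1 - t) * (Rn_dist n z q)\<^sup>2) < t * (F w + t)"
      by (simp add: power2_eq_square algebra_simps)
    then have "(1 - t) * (Rn_dist n z q)\<^sup>2 < F w + t" using t by simp
    also have "\<dots> \<le> D\<^sup>2 / 2 + t" using F_le[OF w(1)] by simp
    also have "\<dots> = (1 - t) * (D\<^sup>2 / 2 + \<eta>)"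
      using t(3) by (simp add: K_def field_simps)
    finally show ?thesis using t(2) by (simp add: mult_less_cancel_left_pos)
  qed
  then show ?thesis using that by blast
qed

section \<open>Large circumradius as an obstruction\<close>

lemma Rn_dist_le_diameter:
  assumes "finite B" "x \<in> B" "y \<in> B"
  shows "Rn_dist n x y \<le> Rn_diameter n B"
proof -
  have "Rn_dist n x y \<le> (SUP (x, y)\<in>B \<times> B. Rn_dist n x y)"
    using assms by (intro cSUP_upper2[where x = "(x, y)"] bdd_above_finite finite_imageI) auto
  then show ?thesis using assms by (auto simp: Rn_diameter_def)
qed

text \<open>
  When \<open>c\<close> is the circumcentre, the sum is the squared circumradius. Here \<open>u\<close> gives the
  barycentric coordinates of \<open>c\<close>, which may be negative.
\<close>

lemma large_circumradius_not_diameter_Ramsey: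
  fixes A :: "'a::euclidean_space set"
  assumes lam: "sum u A = 1" "(\<Sum>x\<in>A. u x *\<^sub>R x) = c"
    and large: "(diameter A)\<^sup>2 / 2 < (\<Sum>x\<in>A. u x * (dist x c)\<^sup>2)"
  shows "\<not> diameter_Ramsey A"
proof
  assume Ramsey: "diameter_Ramsey A"
  define D R L where "D = diameter A" and "R = (\<Sum>x\<in>A. u x * (dist x c)\<^sup>2)"
    and "L = (\<Sum>x\<in>A. \<bar>u x\<bar>)"
  \<comment> \<open>The gap between \<open>R\<close> and \<open>D\<^sup>2 / 2\<close> is halved: one
    \<open>\<eta>\<close> pays for the error in Jung's bound, the other for the shell thickness
    \<open>\<delta>\<close> weighted by \<open>L\<close>.\<close>
  define \<eta> where "\<eta> = (R - D\<^sup>2 / 2) / 2"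
  define \<delta> where "\<delta> = \<eta> / (1 + L)"
  define M where "M = D\<^sup>2 / 2 + \<eta>"
  have L: "0 \<le> L" by (simp add: L_def sum_nonneg)
  have \<eta>: "\<eta> > 0" using large by (simp add: \<eta>_def D_def R_def)
  have \<delta>: "\<delta> > 0" "\<delta> * L < \<eta>" using L \<eta> by (auto simp: \<delta>_def divide_simps)
  have Ane: "A \<noteq> {}" using lam by auto
  \<comment> \<open>Shell indices run from 0 to \<open>nat \<lfloor>M / \<delta>\<rfloor>\<close>
    inclusive. The number is fixed by \<open>A\<close> and \<open>u\<close> before \<open>n\<close>
    and \<open>B\<close> appear.\<close>
  define r where "r = nat \<lfloor>M / \<delta>\<rfloor> + 1"
  have "1 \<le> r" by (simp add: r_def)
  then obtain n B where B: "finite B" "Rn_diameter n B = D"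
    and mono: "\<And>col :: (nat \<Rightarrow> real) \<Rightarrow> nat. col ` B \<subseteq> {..<r} \<Longrightarrow>
      \<exists>A'\<subseteq>B. (\<exists>k. \<forall>x\<in>A'. col x = k) \<and> congruent_in_Rn n A A'"
    using Ramsey unfolding diameter_Ramsey_def D_def by metis
  have Bne: "B \<noteq> {}"
  proof
    assume "B = {}"
    then have "congruent_in_Rn n A {}" using mono[of "\<lambda>_. 0"] by auto
    then show False using Ane by (auto simp: congruent_in_Rn_def bij_betw_def)
  qed
  have "\<And>x y. x \<in> B \<Longrightarrow> y \<in> B \<Longrightarrow> Rn_dist n x y \<le> D"
    using Rn_dist_le_diameter B by metis
  from Rn_jung[OF B(1) Bne \<eta> this]
  obtain q where q: "\<And>z. z \<in> B \<Longrightarrow> (Rn_dist n z q)\<^sup>2 \<le> M"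
    unfolding M_def by blast
  define col where "col = (\<lambda>x. nat \<lfloor>(Rn_dist n x q)\<^sup>2 / \<delta>\<rfloor>)"
  have "col x < r" if "x \<in> B" for x
  proof -
    have "(Rn_dist n x q)\<^sup>2 / \<delta> \<le> M / \<delta>" using q[OF that] \<delta> by (simp add: divide_right_mono)
    then have "nat \<lfloor>(Rn_dist n x q)\<^sup>2 / \<delta>\<rfloor> \<le> nat \<lfloor>M / \<delta>\<rfloor>" by (intro nat_mono floor_mono)
    then show ?thesis by (simp add: col_def r_def)
  qed
  then have "col ` B \<subseteq> {..<r}" by auto
  from mono[OF this] obtain A' k where A': "A' \<subseteq> B" "\<And>x. x \<in> A' \<Longrightarrow> col x = k"
    "congruent_in_Rn n A A'" by blast
  then obtain f where f: "bij_betw f A A'"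
    "\<And>x y. x \<in> A \<Longrightarrow> y \<in> A \<Longrightarrow> Rn_dist n (f x) (f y) = dist x y"
    by (auto simp: congruent_in_Rn_def)
  define s where "s = real k * \<delta>"
  have shell: "s \<le> (Rn_dist n (f x) q)\<^sup>2" "(Rn_dist n (f x) q)\<^sup>2 \<le> s + \<delta>" "s \<le> M"
    if "x \<in> A" for x
  proof -
    have fx: "f x \<in> A'" using f(1) that by (auto simp: bij_betw_def)
    then have "real k = of_int \<lfloor>(Rn_dist n (f x) q)\<^sup>2 / \<delta>\<rfloor>"
      using A'(2)[OF fx] \<delta> by (simp add: col_def flip: A'(2)[OF fx])
    then have "real k \<le> (Rn_dist n (f x) q)\<^sup>2 / \<delta>" "(Rn_dist n (f x) q)\<^sup>2 / \<delta> \<le> real k + 1"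
      by linarith+
    then show "s \<le> (Rn_dist n (f x) q)\<^sup>2" "(Rn_dist n (f x) q)\<^sup>2 \<le> s + \<delta>"
      using \<delta> by (auto simp: s_def field_simps)
    then show "s \<le> M" using q[of "f x"] fx A'(1) by fastforce
  qed
  have "R = (\<Sum>x\<in>A. \<Sum>y\<in>A. u x * u y * (Rn_dist n (f x) (f y))\<^sup>2) / 2"
    using weighted_variance_inner[OF lam(1)] lam(2) by (simp add: R_def f(2) cong: sum.cong)
  \<comment> \<open>Drops the squared distance between \<open>q\<close> and the barycentre of the
    copy, which is nonnegative whatever the signs of \<open>u\<close>.\<close>
  also have "\<dots> \<le> (\<Sum>x\<in>A. u x * (Rn_dist n (f x) q)\<^sup>2)"
    by (simp add: Rn_weighted_variance[OF lam(1)])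
  \<comment> \<open>Since \<open>u\<close> sums to 1, the common value \<open>s\<close> splits off
    and negative weights meet only deviations between 0 and \<open>\<delta>\<close>.\<close>
  also have "\<dots> = s + (\<Sum>x\<in>A. u x * ((Rn_dist n (f x) q)\<^sup>2 - s))"
    using lam(1) by (simp add: algebra_simps sum_subtractf flip: sum_distrib_left)
  also have "(\<Sum>x\<in>A. u x * ((Rn_dist n (f x) q)\<^sup>2 - s)) \<le> (\<Sum>x\<in>A. \<bar>u x\<bar> * \<delta>)"
  proof (rule sum_mono)
    fix x assume x: "x \<in> A"
    have "u x * ((Rn_dist n (f x) q)\<^sup>2 - s) \<le> \<bar>u x\<bar> * ((Rn_dist n (f x) q)\<^sup>2 - s)"
      using shell(1)[OF x] by (intro mult_right_mono) auto
    also have "\<dots> \<le> \<bar>u x\<bar> * \<delta>"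
      using shell(2)[OF x] by (intro mult_left_mono) auto
    finally show "u x * ((Rn_dist n (f x) q)\<^sup>2 - s) \<le> \<bar>u x\<bar> * \<delta>" .
  qed
  also have "\<dots> = \<delta> * L" by (simp add: L_def sum_distrib_left mult.commute)
  finally have "R \<le> s + \<delta> * L" by simp
  then have "R < M + \<eta>" using shell(3) Ane \<delta>(2) by fastforce
  then show False by (simp add: M_def \<eta>_def field_simps)
qed

section \<open>The simplex on the standard basis and a diagonal apex\<close>

definition basis_simplex :: "real \<Rightarrow> 'a::euclidean_space set" where
  "basis_simplex s = insert (s *\<^sub>R One) Basis"

lemma One_inner_Basis: "b \<in> Basis \<Longrightarrow> One \<bullet> b = 1"
  by (simp add: inner_sum_left_Basis)

lemma One_inner_One: "(One::'a::euclidean_space) \<bullet> One = DIM('a)"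
proof -
  have "(One::'a) \<bullet> One = (\<Sum>b\<in>Basis. (One::'a) \<bullet> b)"
    by (rule inner_sum_right)
  then show ?thesis by (simp add: One_inner_Basis)
qed

lemma apex_dist_power2:
  fixes s :: real
  assumes "b \<in> Basis"
  shows "(dist (s *\<^sub>R One) (b::'a::euclidean_space))\<^sup>2 = DIM('a) * s\<^sup>2 - 2 * s + 1"
proof -
  have "(dist (s *\<^sub>R One) b)\<^sup>2 = s\<^sup>2 * (One \<bullet> (One::'a)) - 2 * s * (One \<bullet> b) + b \<bullet> b"
    unfolding dist_norm power2_norm_eq_inner
    by (simp only: inner_diff_left inner_diff_right inner_scaleR_left inner_scaleR_right
        inner_commute[of b One]) (simp add: power2_eq_square algebra_simps)
  then show ?thesis using assms by (simp add: One_inner_One One_inner_Basis)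
qed

lemma Basis_dist_power2:
  assumes "b \<in> Basis" "b' \<in> Basis" "b \<noteq> b'"
  shows "(dist b (b'::'a::euclidean_space))\<^sup>2 = 2"
  using assms by (simp add: dist_norm power2_norm_eq_inner inner_diff inner_not_same_Basis)

text \<open>The basis vectors lie in the hyperplane of coordinate sum 1, while the apex has
  coordinate sum \<open>DIM('a) * s\<close>.\<close>

lemma vertex_simplex_basis_simplex:
  fixes s :: real
  assumes "DIM('a) * s \<noteq> 1"
  shows "vertex_simplex DIM('a) (basis_simplex s :: 'a::euclidean_space set)"
proof -
  have "affine hull Basis \<subseteq> {x::'a. One \<bullet> x = 1}"
    by (rule hull_minimal) (auto simp: One_inner_Basis affine_hyperplane)
  moreover have "One \<bullet> (s *\<^sub>R One :: 'a) \<noteq> 1"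
    using assms by (simp only: inner_scaleR_right One_inner_One mult.commute not_False_eq_True)
  ultimately have out: "(s *\<^sub>R One :: 'a) \<notin> affine hull Basis" by blast
  moreover have "\<not> affine_dependent (Basis::'a set)"
    using affine_dependent_imp_dependent independent_Basis by blast
  ultimately have "\<not> affine_dependent (basis_simplex s :: 'a set)"
    unfolding basis_simplex_def by (rule affine_independent_insert[rotated])
  moreover have "(s *\<^sub>R One :: 'a) \<notin> Basis" using out hull_inc by metis
  ultimately show ?thesis by (simp add: vertex_simplex_def basis_simplex_def)
qed

text \<open>Two basis vectors attain \<open>sqrt 2\<close>; an edge at the apex has squared length
  at most \<open>2 - 2 * s\<close>.\<close>

lemma diameter_basis_simplex:
  fixes s :: real
  assumes "DIM('a) \<ge> 2" "0 \<le> s" "DIM('a) * s\<^sup>2 \<le> 1"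
  shows "diameter (basis_simplex s :: 'a::euclidean_space set) = sqrt 2"
proof -
  obtain b b' :: 'a where bb': "b \<in> Basis" "b' \<in> Basis" "b \<noteq> b'"
    using assms(1) by (metis card_2_iff' ex_card subsetD)
  have le: "dist x y \<le> sqrt 2" if "x \<in> basis_simplex s" "y \<in> basis_simplex s" for x y :: 'a
  proof -
    have "(dist x y)\<^sup>2 \<le> 2"
    proof (cases "x = y")
      case False
      with that consider "x = s *\<^sub>R One" "y \<in> Basis" | "y = s *\<^sub>R One" "x \<in> Basis"
        | "x \<in> Basis" "y \<in> Basis"
        unfolding basis_simplex_def by blast
      then show ?thesis
      proof cases
        case 1
        then show ?thesis using apex_dist_power2[of y s] assms by simp
      next
        case 2
        then show ?thesis using apex_dist_power2[of x s] assms by (simp add: dist_commute)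
      next
        case 3
        then show ?thesis using Basis_dist_power2 False by fastforce
      qed
    qed simp
    then show ?thesis by (rule real_le_rsqrt)
  qed
  have "dist b b' = sqrt 2"
    using Basis_dist_power2[OF bb'] by (metis real_sqrt_unique zero_le_dist)
  moreover have "b \<in> basis_simplex s" "b' \<in> basis_simplex s"
    using bb' by (auto simp: basis_simplex_def)
  ultimately show ?thesis
    unfolding diameter_def using le
    by (auto intro!: cSup_eq_maximum image_eqI[of _ _ "(b, b')"])
qed

text \<open>Used with the apex numbered \<open>d + 1\<close>: edges between basis vectors have full
  length and contribute no defect.\<close>

lemma sum_pairs_last:
  fixes g :: "nat \<times> nat \<Rightarrow> 'b::comm_monoid_add"
  assumes "\<And>i j. 1 \<le> i \<Longrightarrow> i < j \<Longrightarrow> j \<le> d \<Longrightarrow> g (i, j) = 0"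
  shows "(\<Sum>ij\<in>{(i, j). 1 \<le> i \<and> i < j \<and> j \<le> d + 1}. g ij) = (\<Sum>i\<in>{1..d}. g (i, d + 1))"
proof -
  have fin: "finite {(i, j). 1 \<le> i \<and> i < j \<and> j \<le> d + 1}"
    by (rule finite_subset[of _ "{1..d+1} \<times> {1..d+1}"]) auto
  have "(\<Sum>ij\<in>{(i, j). 1 \<le> i \<and> i < j \<and> j \<le> d + 1}. g ij) = (\<Sum>ij\<in>(\<lambda>i. (i, d + 1)) ` {1..d}. g ij)"
    using assms by (intro sum.mono_neutral_right fin) (auto simp: le_Suc_eq image_iff)
  also have "\<dots> = (\<Sum>i\<in>{1..d}. g (i, d + 1))"
    by (subst sum.reindex) (auto simp: inj_on_def)
  finally show ?thesis .
qed

text \<open>Each of the \<open>DIM('a)\<close> edges at the apex has defect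
  \<open>1 + 2 * s - DIM('a) * s\<^sup>2\<close>; the factor 2 on the right is the squared
  diameter.\<close>

lemma almost_regular_basis_simplex:
  fixes s \<epsilon> :: real
  assumes dim: "DIM('a) \<ge> 2" and s: "0 \<le> s" "DIM('a) * s\<^sup>2 \<le> 1" "DIM('a) * s \<noteq> 1"
    and le: "DIM('a) * (1 + 2 * s - DIM('a) * s\<^sup>2) \<le> 2 * (\<epsilon> * ((DIM('a) + 1) choose 2))"
  shows "almost_regular_simplex DIM('a) \<epsilon> (basis_simplex s :: 'a::euclidean_space set)"
proof -
  let ?A = "basis_simplex s :: 'a set" and ?d = "DIM('a)"
  obtain e :: "nat \<Rightarrow> 'a" where e: "bij_betw e {1..?d} Basis"
    using ex_bij_betw_nat_finite_1[OF finite_Basis] by blast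
  define p where "p = (\<lambda>i. if i = ?d + 1 then s *\<^sub>R One else e i)"
  have simplex: "vertex_simplex ?d ?A" using vertex_simplex_basis_simplex s(3) by blast
  have pe: "p i = e i" "p i \<in> Basis" if "i \<in> {1..?d}" for i
    using that e by (auto simp: p_def bij_betw_def)
  have "bij_betw p ({1..?d} \<union> {?d + 1}) (Basis \<union> {s *\<^sub>R One})"
  proof (rule bij_betw_combine)
    show "bij_betw p {1..?d} Basis"
      using e pe(1) by (metis bij_betw_cong)
    show "bij_betw p {?d + 1} {s *\<^sub>R One}" by (simp add: p_def bij_betw_def)
    \<comment> \<open>Otherwise the set would have only \<open>?d\<close> points instead of
      \<open>?d + 1\<close>.\<close>
    have "s *\<^sub>R One \<notin> (Basis :: 'a set)"
      using simplex by (auto simp: vertex_simplex_def basis_simplex_def insert_absorb)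
    then show "Basis \<inter> {s *\<^sub>R One :: 'a} = {}" by blast
  qed
  moreover have "{1..?d} \<union> {?d + 1} = {1..?d + 1}" by auto
  moreover have "Basis \<union> {s *\<^sub>R One} = ?A" by (simp add: basis_simplex_def)
  ultimately have p: "bij_betw p {1..?d + 1} ?A" by metis
  have diam: "(diameter ?A)\<^sup>2 = 2" using diameter_basis_simplex[OF dim s(1,2)] by simp
  have zero: "2 - (norm (p i - p j))\<^sup>2 = 0" if "1 \<le> i" "i < j" "j \<le> ?d" for i j
  proof -
    have "p i \<noteq> p j" using p that by (auto simp: bij_betw_def dest: inj_onD)
    then show ?thesis using Basis_dist_power2[of "p i" "p j"] pe that by (simp add: dist_norm)
  qed
  have "(\<Sum>(i, j)\<in>{(i, j). 1 \<le> i \<and> i < j \<and> j \<le> ?d + 1}. (diameter ?A)\<^sup>2 - (norm (p i - p j))\<^sup>2) =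
      (\<Sum>i\<in>{1..?d}. 2 - (norm (p i - p (?d + 1)))\<^sup>2)"
    unfolding diam using zero by (subst sum_pairs_last) auto
  also have "\<dots> = (\<Sum>i\<in>{1..?d}. 1 + 2 * s - ?d * s\<^sup>2)"
  proof (rule sum.cong)
    fix i assume "i \<in> {1..?d}"
    then show "2 - (norm (p i - p (?d + 1)))\<^sup>2 = 1 + 2 * s - ?d * s\<^sup>2"
      using apex_dist_power2[of "p i" s] pe(2)[of i]
      by (simp add: p_def dist_norm norm_minus_commute)
  qed simp
  finally have "(\<Sum>(i, j)\<in>{(i, j). 1 \<le> i \<and> i < j \<and> j \<le> ?d + 1}.
      (diameter ?A)\<^sup>2 - (norm (p i - p j))\<^sup>2) \<le> 2 * (\<epsilon> * ((?d + 1) choose 2))"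
    using le by simp
  moreover have "0 < real ((?d + 1) choose 2)"
    using dim by (simp add: zero_less_binomial_iff)
  ultimately have "1 / real ((?d + 1) choose 2) *
      (\<Sum>(i, j)\<in>{(i, j). 1 \<le> i \<and> i < j \<and> j \<le> ?d + 1}.
        (diameter ?A)\<^sup>2 - (norm (p i - p j))\<^sup>2) \<le> \<epsilon> * (diameter ?A)\<^sup>2"
    unfolding diam by (simp add: pos_divide_le_eq mult_ac)
  with simplex p show ?thesis unfolding almost_regular_simplex_def by blast
qed

text \<open>The origin serves as \<open>c\<close>, though it is not the circumcentre: by the
  variance identity the sum is the squared circumradius minus the squared distance from
  \<open>c\<close> to the circumcentre. The apex has negative weight and norm below 1, which pushes
  the sum above 1.\<close>

lemma not_diameter_Ramsey_basis_simplex: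
  fixes s :: real
  assumes dim: "DIM('a) \<ge> 2" and s: "1 < DIM('a) * s" "DIM('a) * s\<^sup>2 < 1"
  shows "\<not> diameter_Ramsey (basis_simplex s :: 'a::euclidean_space set)"
proof (rule large_circumradius_not_diameter_Ramsey)
  let ?d = "real DIM('a)" and ?a = "s *\<^sub>R One :: 'a"
  \<comment> \<open>Barycentric coordinates of the origin, from \<open>s *\<^sub>R One\<close> minus
    the apex being 0, normalised to total 1.\<close>
  define u where "u x = (if x = ?a then - 1 else s) / (?d * s - 1)" for x
  have "0 < s" using s(1) by (smt (verit) mult_nonneg_nonpos of_nat_0_le_iff)
  have "vertex_simplex DIM('a) (basis_simplex s :: 'a set)"
    using vertex_simplex_basis_simplex s(1) by (metis less_irrefl)
  then have a: "?a \<notin> Basis" by (auto simp: vertex_simplex_def basis_simplex_def insert_absorb)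
  then have lam: "u ?a = - 1 / (?d * s - 1)" "\<And>b. b \<in> Basis \<Longrightarrow> u b = s / (?d * s - 1)"
    by (auto simp: u_def)
  have split: "sum g (basis_simplex s) = g ?a + sum g Basis" for g :: "'a \<Rightarrow> 'b::comm_monoid_add"
    unfolding basis_simplex_def using a by (intro sum.insert) auto
  have "sum u (basis_simplex s) = (?d * s - 1) / (?d * s - 1)"
    unfolding diff_divide_distrib by (simp add: split lam)
  then show "sum u (basis_simplex s) = 1" using s(1) by simp
  have "(\<Sum>b\<in>(Basis::'a set). u b *\<^sub>R b) = (s / (?d * s - 1)) *\<^sub>R One"
    unfolding scaleR_right.sum by (simp add: lam)
  moreover have "u ?a *\<^sub>R ?a = - ((s / (?d * s - 1)) *\<^sub>R One)"
    unfolding lam by simp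
  ultimately show "(\<Sum>x\<in>basis_simplex s. u x *\<^sub>R x) = 0"
    unfolding split by (simp only: add.left_inverse)
  have "(diameter (basis_simplex s :: 'a set))\<^sup>2 / 2 = 1"
    using diameter_basis_simplex[OF dim] \<open>0 < s\<close> s(2) by simp
  \<comment> \<open>Clearing the positive denominator leaves
    \<open>?d * s\<^sup>2 < 1\<close>.\<close>
  also have "\<dots> < (- ?d * s\<^sup>2 + ?d * s) / (?d * s - 1)"
    using s by (simp add: less_divide_eq)
  also have "\<dots> = u ?a * (norm ?a)\<^sup>2 + (\<Sum>b\<in>(Basis::'a set). u b * (norm b)\<^sup>2)"
  proof -
    have "(norm ?a)\<^sup>2 = ?d * s\<^sup>2"
      unfolding power2_norm_eq_inner inner_scaleR_left inner_scaleR_right One_inner_One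
      by (simp add: power2_eq_square)
    then show ?thesis
      by (simp add: lam diff_divide_distrib)
  qed
  also have "\<dots> = (\<Sum>x\<in>basis_simplex s. u x * (dist x 0)\<^sup>2)"
    by (simp add: split)
  finally show "(diameter (basis_simplex s :: 'a set))\<^sup>2 / 2 <
      (\<Sum>x\<in>basis_simplex s. u x * (dist x 0)\<^sup>2)" .
qed

section \<open>Choosing the apex parameter\<close>

theorem corollary1p4:
  fixes \<epsilon> :: real
  assumes "CARD('d::finite) \<ge> 2"
    and "\<epsilon> > sqrt (real CARD('d)) / real ((CARD('d) + 1) choose 2)"
  shows "\<exists>A :: (real ^ 'd) set. almost_regular_simplex CARD('d) \<epsilon> A \<and> \<not> diameter_Ramsey A"
proof -
  define d where "d = real CARD('d)"
  let ?C = "real ((CARD('d) + 1) choose 2)" and ?s = "1 / sqrt d"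
  have d: "d \<ge> 2" using assms(1) by (simp add: d_def)
  have "0 < ?C" using assms(1) by (simp add: zero_less_binomial_iff)
  then have \<epsilon>: "sqrt d < \<epsilon> * ?C" using assms(2) by (simp add: d_def pos_divide_less_eq)
  \<comment> \<open>At \<open>?s\<close> the total defect is exactly \<open>2 * sqrt d\<close>, the
    source of the threshold for \<open>\<epsilon>\<close>. The strict inequality survives a small
    move to the left by continuity.\<close>
  have "d * 2 / sqrt d = 2 * sqrt d" using d by (simp add: field_simps)
  then have "d * (1 + 2 * ?s - d * ?s\<^sup>2) < 2 * (\<epsilon> * ?C)"
    using \<epsilon> d by (simp add: power_divide)
  moreover have "((\<lambda>s. d * (1 + 2 * s - d * s\<^sup>2)) \<longlongrightarrow> d * (1 + 2 * ?s - d * ?s\<^sup>2)) (at_left ?s)"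
    by (intro tendsto_intros)
  ultimately have "\<forall>\<^sub>F s in at_left ?s. d * (1 + 2 * s - d * s\<^sup>2) < 2 * (\<epsilon> * ?C)"
    by (rule order_tendstoD(2)[rotated])
  \<comment> \<open>The upper end gives \<open>d * s\<^sup>2 < 1\<close>, the lower end
    \<open>1 < d * s\<close>; the interval is nonempty because \<open>d > 1\<close>.\<close>
  moreover have "\<forall>\<^sub>F s in at_left ?s. s \<in> {1 / d<..<?s}"
  proof (rule eventually_at_leftI)
    have "sqrt d < d" using d by (simp add: real_sqrt_less_iff real_less_lsqrt power2_eq_square)
    then show "1 / d < ?s" using d by (simp add: frac_less2)
  qed
  ultimately obtain s where s: "d * (1 + 2 * s - d * s\<^sup>2) < 2 * (\<epsilon> * ?C)" "1 / d < s" "s < ?s"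
    using eventually_happens'[OF trivial_limit_at_left_real, OF eventually_conj] by force
  have "0 < s" using s(2) d by (smt (verit) divide_pos_pos)
  have "1 < d * s" using s(2) d by (simp add: field_simps)
  have "s\<^sup>2 < ?s\<^sup>2" using s(3) \<open>0 < s\<close> by (intro power_strict_mono) auto
  then have "d * s\<^sup>2 < 1" using d by (simp add: power_divide field_simps)
  have "almost_regular_simplex DIM(real ^ 'd) \<epsilon> (basis_simplex s :: (real ^ 'd) set)"
    using assms(1) s(1) \<open>0 < s\<close> \<open>1 < d * s\<close> \<open>d * s\<^sup>2 < 1\<close>
    by (intro almost_regular_basis_simplex) (simp_all add: d_def)
  moreover have "\<not> diameter_Ramsey (basis_simplex s :: (real ^ 'd) set)"
    using assms(1) \<open>1 < d * s\<close> \<open>d * s\<^sup>2 < 1\<close>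
    by (intro not_diameter_Ramsey_basis_simplex) (simp_all add: d_def)
  ultimately show ?thesis by auto
qed

end
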